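(* Let $(\theta^*,\phi^* )$ be the saddle point, described in the context, of the zero-sum game between attacker and detector, and let the attack signal $\theta^*(t)=\bar\theta$ be fixed, where $\bar\theta:=\frac{1}{\sqrt T}\Phi^{-1}(c)+d$. Then the relative entropy rate and the variance rate are $$\bar D(\mu\|\mu_{\theta^*})=\frac12\bar\theta^2,\qquad \bar V(\mu\|\mu_{\theta^*})=\bar\theta^2,$$ and the detection failure rate (type II error probability) at the saddle point, i.e. the value of the game, satisfies $$-\log\beta(\theta^*,\phi^* )\ \ge\ T\,\bar D(\mu\|\mu_{\theta^*})+\sqrt T\,\sqrt{\bar V(\mu\|\mu_{\theta^*})}\;\Phi^{-1}(\epsilon)+\text{const.},$$ where const. denotes a constant independent of $T$.
   Context: Let $T>0$ be the horizon length and let $d>0$, $c>\tfrac12$, $\epsilon\in(0,\tfrac12)$ be given constants. $\Phi$ is the standard normal cumulative distribution function. Let $w(t)$, $0\le t\le T$, be a standard one-dimensional Brownian motion under a probability measure $\mu$. An attacker chooses a deterministic Borel measurable attack signal $\theta:[0,T]\to\mathbb R$ with $\int_0^T|\theta(t)|\,dt<\infty$, and the observed trajectory is $dx(t)=\theta(t)\,dt+dw(t)$, $x(0)=0$. The attack success rate is $\gamma(\theta):=\Phi\big(\tfrac{1}{\sqrt T}\int_0^T\theta(t)\,dt-\sqrt T\,d\big)$, the probability that $x(T)>Td$; the attacker must ensure $\gamma(\theta)\ge c$. A detector chooses a test $\phi:C[0,T]\to\{0,1\}$ (1 meaning "alarm"), where $C[0,T]$ is the space of continuous functions $[0,T]\to\mathbb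 R$. The false alarm rate $\alpha(\phi)$ is the probability that $\phi(x)=1$ when $\theta=0$, and the detector must ensure $\alpha(\phi)\le\epsilon$. The detection failure rate is $\beta(\theta,\phi):=1-\mathbb E^{\mu}[\phi(x)]$, the probability that $\phi(x)=0$ when $x$ is generated with attack signal $\theta$. The detector minimizes and the attacker maximizes $\beta(\theta,\phi)$ under these constraints. The saddle point of this game is $\theta^*(t)=\bar\theta=\frac{1}{\sqrt T}\Phi^{-1}(c)+d$ for all $t\in[0,T]$, together with $\phi^*(x)=1$ if $x(T)>\sqrt T\,\Phi^{-1}(1-\epsilon)$ and $\phi^*(x)=0$ if $x(T)\le\sqrt T\,\Phi^{-1}(1-\epsilon)$. Let $\mu_{\theta^*}$ be the measure (given by Girsanov's theorem) under which the trajectory $x$ generated with $\theta=\theta^*$ is a standard Brownian motion, with log-likelihood ratio $$\log z_{\theta^*}=\log\frac{d\mu}{d\mu_{\theta^*}}=\int_0^T\theta^*(t)\,dw(t)+\frac12\int_0^T\theta^*(t)^2\,dt .$$ Define $D(\mu\|\mu_{\theta^*}):=\mathbb E^\mu[\log z_{\theta^*}]$ and $V(\mu\|\mu_{\theta^*}):=\mathbb E^\mu\big[(D(\mu\|\mu_{\theta^*})-\log z_{\theta^*})^2\big]$, and the rates $\bar D(\mu\|\mu_{\theta^*}):=\limsup_{T\to\infty}\frac1T D(\mu\|\mu_{\theta^*})$ and $\bar V(\mu\|\mu_{\theta^*}):=\limsup_{T\to\infty}\frac1T V(\mu\|\mu_{\theta^*})$. *)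

theory Defs
  imports "HOL-Probability.Probability"
begin

locale brownian_motion = prob_space M for M :: "'a measure" +
  fixes W :: "real \<Rightarrow> 'a \<Rightarrow> real"
  assumes random_variable_W: "\<And>t. 0 \<le> t \<Longrightarrow> random_variable borel (W t)"
    and start_0: "\<And>\<omega>. \<omega> \<in> space M \<Longrightarrow> W 0 \<omega> = 0"
    and gaussian_increments: "\<And>s t. 0 \<le> s \<Longrightarrow> s < t \<Longrightarrow>
      distributed M lborel (\<lambda>\<omega>. W t \<omega> - W s \<omega>) (normal_density 0 (sqrt (t - s)))"
    and indep_increments: "\<And>(t :: nat \<Rightarrow> real) n. 0 \<le> t 0 \<Longrightarrow> mono t \<Longrightarrow>
      indep_vars (\<lambda>_. borel) (\<lambda>i \<omega>. W (t (Suc i)) \<omega> - W (t i) \<omega>) {..<n}"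
    and continuous_paths: "\<And>\<omega>. \<omega> \<in> space M \<Longrightarrow> continuous_on {0..} (\<lambda>t. W t \<omega>)"

definition Phi :: "real \<Rightarrow> real" where
  "Phi = cdf std_normal_distribution"

(* Phi is a bijection from the reals onto the open unit interval;
   outside that interval the value of Phi_inv is unspecified. *)
definition Phi_inv :: "real \<Rightarrow> real" where
  "Phi_inv = inv Phi"

(* C[0,T], its elements being extensional functions on {0..T}. The trace of the
   product sigma-algebra is the Borel sigma-algebra of the supremum norm. *)
definition path_space :: "real \<Rightarrow> (real \<Rightarrow> real) measure" where
  "path_space T = restrict_space (PiM {0..T} (\<lambda>_. borel)) {x. continuous_on {0..T} x}"

definition trajectory ::
  "(real \<Rightarrow> 'a \<Rightarrow> real) \<Rightarrow> real \<Rightarrow> (real \<Rightarrow> real) \<Rightarrow> 'a \<Rightarrow> real \<Rightarrow> real" where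
  "trajectory W T \<theta> \<omega> = (\<lambda>t\<in>{0..T}. (LBINT s:{0..t}. \<theta> s) + W t \<omega>)"

definition success_rate :: "real \<Rightarrow> real \<Rightarrow> (real \<Rightarrow> real) \<Rightarrow> real" where
  "success_rate T d \<theta> = Phi ((LBINT t:{0..T}. \<theta> t) / sqrt T - sqrt T * d)"

definition false_alarm_rate ::
  "'a measure \<Rightarrow> (real \<Rightarrow> 'a \<Rightarrow> real) \<Rightarrow> real \<Rightarrow> ((real \<Rightarrow> real) \<Rightarrow> real) \<Rightarrow> real" where
  "false_alarm_rate M W T \<phi> = measure M {\<omega> \<in> space M. \<phi> (trajectory W T (\<lambda>_. 0) \<omega>) = 1}"

definition failure_rate ::
  "'a measure \<Rightarrow> (real \<Rightarrow> 'a \<Rightarrow> real) \<Rightarrow> real \<Rightarrow> (real \<Rightarrow> real) \<Rightarrow> ((real \<Rightarrow> real) \<Rightarrow> real) \<Rightarrow> real" where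
  "failure_rate M W T \<theta> \<phi> = 1 - (\<integral>\<omega>. \<phi> (trajectory W T \<theta> \<omega>) \<partial>M)"

definition attacker_feasible :: "real \<Rightarrow> real \<Rightarrow> real \<Rightarrow> (real \<Rightarrow> real) \<Rightarrow> bool" where
  "attacker_feasible T d c \<theta> \<longleftrightarrow>
     set_integrable lborel {0..T} \<theta> \<and> success_rate T d \<theta> \<ge> c"

definition detector_feasible ::
  "'a measure \<Rightarrow> (real \<Rightarrow> 'a \<Rightarrow> real) \<Rightarrow> real \<Rightarrow> real \<Rightarrow> ((real \<Rightarrow> real) \<Rightarrow> real) \<Rightarrow> bool" where
  "detector_feasible M W T \<epsilon> \<phi> \<longleftrightarrow>
     \<phi> \<in> borel_measurable (path_space T) \<and> \<phi> ` space (path_space T) \<subseteq> {0, 1} \<and>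
     false_alarm_rate M W T \<phi> \<le> \<epsilon>"

definition saddle_point ::
  "'a measure \<Rightarrow> (real \<Rightarrow> 'a \<Rightarrow> real) \<Rightarrow> real \<Rightarrow> real \<Rightarrow> real \<Rightarrow> real \<Rightarrow>
     (real \<Rightarrow> real) \<Rightarrow> ((real \<Rightarrow> real) \<Rightarrow> real) \<Rightarrow> bool" where
  "saddle_point M W T d c \<epsilon> \<theta>' \<phi>' \<longleftrightarrow>
     attacker_feasible T d c \<theta>' \<and> detector_feasible M W T \<epsilon> \<phi>' \<and>
     (\<forall>\<theta>. attacker_feasible T d c \<theta> \<longrightarrow>
        failure_rate M W T \<theta> \<phi>' \<le> failure_rate M W T \<theta>' \<phi>') \<and>
     (\<forall>\<phi>. detector_feasible M W T \<epsilon> \<phi> \<longrightarrow>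
        failure_rate M W T \<theta>' \<phi>' \<le> failure_rate M W T \<theta>' \<phi>)"

definition theta_bar :: "real \<Rightarrow> real \<Rightarrow> real \<Rightarrow> real" where
  "theta_bar T d c = 1 / sqrt T * Phi_inv c + d"

definition phi_star :: "real \<Rightarrow> real \<Rightarrow> (real \<Rightarrow> real) \<Rightarrow> real" where
  "phi_star T \<epsilon> x = (if x T > sqrt T * Phi_inv (1 - \<epsilon>) then 1 else 0)"

(* Pathwise limit of left-point Riemann sums. For a continuous integrand of bounded
   variation this is the stochastic integral of the integrand; it is only evaluated
   at constant integrands below. *)
definition wiener_integral ::
  "(real \<Rightarrow> 'a \<Rightarrow> real) \<Rightarrow> real \<Rightarrow> (real \<Rightarrow> real) \<Rightarrow> 'a \<Rightarrow> real" where
  "wiener_integral W T \<theta> \<omega> =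
     lim (\<lambda>n. \<Sum>k<n. \<theta> (real k * T / real n) *
            (W (real (Suc k) * T / real n) \<omega> - W (real k * T / real n) \<omega>))"

(* Girsanov's theorem: under this measure the trajectory on [0,T] with drift \<theta>
   is a standard Brownian motion. *)
definition girsanov_measure ::
  "'a measure \<Rightarrow> (real \<Rightarrow> 'a \<Rightarrow> real) \<Rightarrow> real \<Rightarrow> (real \<Rightarrow> real) \<Rightarrow> 'a measure" where
  "girsanov_measure M W T \<theta> =
     density M (\<lambda>\<omega>. ennreal (exp (- (wiener_integral W T \<theta> \<omega> + 1/2 * (LBINT t:{0..T}. (\<theta> t)\<^sup>2)))))"

(* entropy_density (exp 1) N M is the natural logarithm of dM/dN. *)
definition log_likelihood_ratio ::
  "'a measure \<Rightarrow> (real \<Rightarrow> 'a \<Rightarrow> real) \<Rightarrow> real \<Rightarrow> (real \<Rightarrow> real) \<Rightarrow> 'a \<Rightarrow> real" where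
  "log_likelihood_ratio M W T \<theta> = entropy_density (exp 1) (girsanov_measure M W T \<theta>) M"

(* This is KL_divergence (exp 1) (girsanov_measure M W T \<theta>) M. *)
definition relative_entropy ::
  "'a measure \<Rightarrow> (real \<Rightarrow> 'a \<Rightarrow> real) \<Rightarrow> real \<Rightarrow> (real \<Rightarrow> real) \<Rightarrow> real" where
  "relative_entropy M W T \<theta> = (\<integral>\<omega>. log_likelihood_ratio M W T \<theta> \<omega> \<partial>M)"

definition relative_variance ::
  "'a measure \<Rightarrow> (real \<Rightarrow> 'a \<Rightarrow> real) \<Rightarrow> real \<Rightarrow> (real \<Rightarrow> real) \<Rightarrow> real" where
  "relative_variance M W T \<theta> =
     (\<integral>\<omega>. (relative_entropy M W T \<theta> - log_likelihood_ratio M W T \<theta> \<omega>)\<^sup>2 \<partial>M)"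

definition entropy_rate ::
  "'a measure \<Rightarrow> (real \<Rightarrow> 'a \<Rightarrow> real) \<Rightarrow> (real \<Rightarrow> real) \<Rightarrow> ereal" where
  "entropy_rate M W \<theta> = Limsup at_top (\<lambda>T. ereal (1 / T * relative_entropy M W T \<theta>))"

definition variance_rate ::
  "'a measure \<Rightarrow> (real \<Rightarrow> 'a \<Rightarrow> real) \<Rightarrow> (real \<Rightarrow> real) \<Rightarrow> ereal" where
  "variance_rate M W \<theta> = Limsup at_top (\<lambda>T. ereal (1 / T * relative_variance M W T \<theta>))"

end

(* At the saddle point beta = Phi (-u) with u = sqrt T * a + Phi_inv eps and a the constant
   attack signal, while the claimed lower bound for -log beta equals
   u^2/2 - (Phi_inv eps)^2/2 + const. For u >= 0 the Chernoff bound Phi (-u) <= exp (-u^2/2)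
   suffices; for u < 0 we have |u| <= |Phi_inv eps|, so the bound is nonpositive.
   Hence const = 0 works for all T and a > 0. For constant signals the log-likelihood ratio
   is a W(T) + a^2 T/2, so both rates are limits of constant functions of T. *)

theory Submission
  imports Defs
begin

section \<open>The standard normal distribution function\<close>

interpretation std_normal: real_distribution std_normal_distribution
  by (rule real_dist_normal_dist)

lemma (in prob_space) prob_std_normal_le:
  assumes "distributed M lborel X std_normal_density"
  shows "measure M {\<omega> \<in> space M. X \<omega> \<le> x} = Phi x"
proof -
  have X: "X \<in> borel_measurable M"
    using distributed_measurable[OF assms] by simp
  have "Phi x = measure (distr M lborel X) {..x}"
    using assms by (simp add: Phi_def cdf_def distributed_distr_eq_density)
  also have "\<dots> = measure M (X -` {..x} \<inter> space M)"
    using X by (simp add: measure_distr)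
  also have "X -` {..x} \<inter> space M = {\<omega> \<in> space M. X \<omega> \<le> x}"
    by auto
  finally show ?thesis by simp
qed

text \<open>The normal density is positive everywhere, so null sets of the normal law are Lebesgue
  null.\<close>

lemma AE_lborel_if_AE_normal:
  assumes "\<sigma> > 0" "AE x in density lborel (normal_density \<mu> \<sigma>). P x"
  shows "AE x in lborel. P x"
  using assms by (simp add: AE_density normal_density_pos)

text \<open>Absence of atoms makes \<open>Phi\<close> continuous and makes open and closed rays
  equally likely.\<close>

lemma std_normal_singleton: "measure std_normal_distribution {x} = 0"
proof -
  have "AE y in std_normal_distribution. y \<notin> {x}"
    by (subst AE_density) (auto intro: AE_mp[OF AE_lborel_singleton[of x]])
  then show ?thesis
    by (subst (asm) AE_iff_measurable[of "{x}"]) (auto simp: measure_def)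
qed

text \<open>Otherwise the interval would be Lebesgue null, against its length
  \<open>y - x\<close>.\<close>

lemma std_normal_interval_pos:
  assumes "x < y"
  shows "0 < measure std_normal_distribution {x<..y}"
proof (rule ccontr)
  assume "\<not> ?thesis"
  then have "measure std_normal_distribution {x<..y} = 0"
    using measure_nonneg[of std_normal_distribution "{x<..y}"] by linarith
  then have "emeasure std_normal_distribution {x<..y} = 0"
    by (simp add: std_normal.emeasure_eq_measure)
  then have "AE z in std_normal_distribution. z \<notin> {x<..y}"
    by (subst AE_iff_measurable[of "{x<..y}"]) auto
  then have "AE z in lborel. z \<notin> {x<..y}"
    by (rule AE_lborel_if_AE_normal[rotated]) simp
  then have "emeasure lborel {x<..y} = 0"
    by (subst (asm) AE_iff_measurable[of "{x<..y}"]) auto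
  with assms show False by simp
qed

section \<open>Monotonicity, reflection and inversion of \<open>Phi\<close>\<close>

lemma Phi_strict_mono: "strict_mono Phi"
  unfolding strict_mono_def Phi_def
  using std_normal.cdf_diff_eq std_normal_interval_pos by fastforce

lemma Phi_pos: "0 < Phi x"
proof -
  have "Phi (x - 1) < Phi x"
    using Phi_strict_mono by (simp add: strict_mono_def)
  moreover have "0 \<le> Phi (x - 1)"
    by (simp add: Phi_def std_normal.cdf_nonneg)
  ultimately show ?thesis by linarith
qed

lemma Phi_le_1: "Phi x \<le> 1"
  by (simp add: Phi_def std_normal.cdf_bounded_prob)

text \<open>The standard normal law is invariant under negation, obtained here as the affine map
  with offset 0 and factor -1.\<close>

lemma Phi_uminus: "Phi (- x) = 1 - Phi x"
proof -
  let ?N = std_normal_distribution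
  have id: "distributed ?N lborel (\<lambda>x. x) std_normal_density"
    by (simp add: distributed_def distr_id2)
  then have "distributed ?N lborel (\<lambda>x. 0 + -1 * x) (normal_density (0 + -1 * 0) (\<bar>-1\<bar> * 1))"
    by (intro std_normal.normal_density_affine) auto
  then have neg: "distributed ?N lborel (\<lambda>x. - x) std_normal_density"
    by simp
  have "Phi (- x) = measure ?N {z. x \<le> z}"
    using std_normal.prob_std_normal_le[OF neg, of "- x"] by simp
  also have "{z. x \<le> z} = {x} \<union> (space ?N - {..x})"
    by auto
  also have "measure ?N \<dots> = measure ?N {x} + measure ?N (space ?N - {..x})"
    by (rule std_normal.finite_measure_Union) auto
  also have "measure ?N (space ?N - {..x}) = 1 - measure ?N {..x}"
    by (rule std_normal.prob_compl) auto
  finally show ?thesis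
    by (simp add: std_normal_singleton Phi_def cdf_def)
qed

text \<open>\<open>inv\<close> returns a preimage only for values in the range, so surjectivity onto
  (0,1) comes first, from the limits of \<open>Phi\<close> and the intermediate value
  theorem.\<close>

lemma Phi_Phi_inv:
  assumes "0 < p" "p < 1"
  shows "Phi (Phi_inv p) = p"
proof -
  have "eventually (\<lambda>x. Phi x < p) at_bot"
    using order_tendstoD(2)[OF std_normal.cdf_lim_at_bot assms(1)] by (simp add: Phi_def)
  then obtain a where a: "Phi a < p"
    by (auto simp: eventually_at_bot_linorder)
  have "eventually (\<lambda>x. p < Phi x) at_top"
    using order_tendstoD(1)[OF std_normal.cdf_lim_at_top_prob assms(2)] by (simp add: Phi_def)
  then obtain b where b: "p < Phi b"
    by (auto simp: eventually_at_top_linorder)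
  have "a \<le> b"
    using a b strict_mono_less[OF Phi_strict_mono, of a b] by linarith
  moreover have "\<forall>x. a \<le> x \<and> x \<le> b \<longrightarrow> isCont Phi x"
    by (simp add: Phi_def std_normal.isCont_cdf std_normal_singleton)
  ultimately obtain x where "Phi x = p"
    using IVT[of Phi a p b] a b by auto
  then show ?thesis
    unfolding Phi_inv_def by (metis f_inv_into_f rangeI)
qed

lemma Phi_inv_eqI: "Phi x = p \<Longrightarrow> Phi_inv p = x"
  unfolding Phi_inv_def
  using Phi_strict_mono by (auto intro: inv_f_f strict_mono_imp_inj_on)

lemma Phi_inv_one_minus:
  assumes "0 < p" "p < 1"
  shows "Phi_inv (1 - p) = - Phi_inv p"
  using assms by (intro Phi_inv_eqI) (simp add: Phi_uminus Phi_Phi_inv)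

lemma Phi_0: "Phi 0 = 1/2"
  using Phi_uminus[of 0] by simp

lemma Phi_inv_pos:
  assumes "1/2 < p" "p < 1"
  shows "0 < Phi_inv p"
  using assms Phi_Phi_inv[of p] strict_mono_less[OF Phi_strict_mono, of 0 "Phi_inv p"]
  by (simp add: Phi_0)

lemma Phi_inv_neg:
  assumes "0 < p" "p < 1/2"
  shows "Phi_inv p < 0"
  using assms Phi_Phi_inv[of p] strict_mono_less[OF Phi_strict_mono, of "Phi_inv p" 0]
  by (simp add: Phi_0)

(* For x <= -u the standard normal density is at most exp (-u^2/2) times the density
   of mean -u, which integrates to 1. *)
lemma Phi_tail_le:
  assumes "0 \<le> u"
  shows "Phi (- u) \<le> exp (- u\<^sup>2 / 2)"
proof -
  interpret shifted: prob_space "density lborel (normal_density (- u) 1)"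
    by (rule prob_space_normal_density) simp
  have le: "std_normal_density x \<le> exp (- u\<^sup>2 / 2) * normal_density (- u) 1 x" if "x \<le> - u" for x
  proof -
    \<comment> \<open>This is the cross term in the expansion of \<open>x\<^sup>2\<close> around
      \<open>- u\<close>; dropping it compares the two exponents.\<close>
    have "0 \<le> u * (- u - x)"
      using that assms by simp
    moreover have "x\<^sup>2 = u\<^sup>2 + (x + u)\<^sup>2 + 2 * (u * (- u - x))"
      by (simp add: power2_eq_square algebra_simps)
    ultimately have "- x\<^sup>2 / 2 \<le> - u\<^sup>2 / 2 - (x + u)\<^sup>2 / 2"
      by linarith
    then have "exp (- x\<^sup>2 / 2) \<le> exp (- u\<^sup>2 / 2) * exp (- (x + u)\<^sup>2 / 2)"
      by (simp flip: exp_add)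
    then show ?thesis
      by (simp add: normal_density_def divide_right_mono)
  qed
  have "ennreal (Phi (- u)) = emeasure std_normal_distribution {..- u}"
    by (simp add: Phi_def cdf_def std_normal.emeasure_eq_measure)
  also have "\<dots> = (\<integral>\<^sup>+x. ennreal (std_normal_density x) * indicator {..- u} x \<partial>lborel)"
    by (simp add: emeasure_density)
  also have "\<dots> \<le> (\<integral>\<^sup>+x. ennreal (exp (- u\<^sup>2 / 2)) * ennreal (normal_density (- u) 1 x) \<partial>lborel)"
    using le by (intro nn_integral_mono) (auto simp: indicator_def ennreal_mult[symmetric])
  also have "\<dots> = ennreal (exp (- u\<^sup>2 / 2)) * (\<integral>\<^sup>+x. ennreal (normal_density (- u) 1 x) \<partial>lborel)"
    by (rule nn_integral_cmult) simp
  also have "(\<integral>\<^sup>+x. ennreal (normal_density (- u) 1 x) \<partial>lborel) = 1"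
    using shifted.emeasure_space_1 by (simp add: emeasure_density)
  finally show ?thesis by simp
qed

section \<open>Constant attack signals\<close>

lemma set_lebesgue_integral_const_Icc:
  fixes a :: real
  assumes "0 \<le> T"
  shows "(LBINT t:{0..T}. a) = a * T"
  using assms by (simp add: set_lebesgue_integral_def)

context brownian_motion
begin

section \<open>Marginal law and moments of the Brownian motion\<close>

lemma W_distributed:
  assumes "0 < T"
  shows "distributed M lborel (W T) (normal_density 0 (sqrt T))"
proof -
  have "distributed M lborel (\<lambda>\<omega>. W T \<omega> - W 0 \<omega>) (normal_density 0 (sqrt (T - 0)))"
    using assms by (intro gaussian_increments) auto
  \<comment> \<open>\<open>start_0\<close> speaks only of points of \<open>space M\<close>, hence
    the congruence rules instead of an equality of functions.\<close>
  moreover have "distributed M lborel (\<lambda>\<omega>. W T \<omega> - W 0 \<omega>) f = distributed M lborel (W T) f" for f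
    by (simp add: distributed_def start_0 cong: measurable_cong distr_cong)
  ultimately show ?thesis by simp
qed

lemma expectation_W: "0 < T \<Longrightarrow> expectation (W T) = 0"
  by (rule normal_distributed_expectation[OF _ W_distributed]) auto

lemma expectation_W_squared: "0 < T \<Longrightarrow> expectation (\<lambda>\<omega>. (W T \<omega>)\<^sup>2) = T"
  using normal_distributed_variance[OF _ W_distributed, of T] by (simp add: expectation_W)

lemma integrable_W: "0 < T \<Longrightarrow> integrable M (W T)"
  using distributed_integrable[OF W_distributed, of T "\<lambda>x. x"] integrable_normal_moment_nz_1[of "sqrt T" 0]
  by simp

lemma prob_W_le:
  assumes "0 < T"
  shows "measure M {\<omega> \<in> space M. W T \<omega> \<le> x} = Phi (x / sqrt T)"
proof -
  have "distributed M lborel (\<lambda>\<omega>. (W T \<omega> - 0) / sqrt T) std_normal_density"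
    using normal_standard_normal_convert[of "sqrt T" "W T" 0] W_distributed[OF assms] assms by simp
  from prob_std_normal_le[OF this, of "x / sqrt T"] show ?thesis
    using assms by (simp add: divide_le_cancel)
qed

section \<open>Stochastic integral and likelihood ratio of a constant signal\<close>

text \<open>The Riemann sums telescope, so the sequence is constant except at \<open>n = 0\<close>,
  where the sum is empty.\<close>

lemma wiener_integral_const:
  assumes "\<omega> \<in> space M"
  shows "wiener_integral W T (\<lambda>_. a) \<omega> = a * W T \<omega>"
proof -
  have "(\<Sum>k<n. a * (W (real (Suc k) * T / real n) \<omega> - W (real k * T / real n) \<omega>)) = a * W T \<omega>"
    if "0 < n" for n :: nat
    using that assms sum_lessThan_telescope[of "\<lambda>k. W (real k * T / real n) \<omega>" n]
    by (simp add: start_0 flip: sum_distrib_left)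
  then have "eventually (\<lambda>n. (\<Sum>k<n. a * (W (real (Suc k) * T / real n) \<omega> -
      W (real k * T / real n) \<omega>)) = a * W T \<omega>) sequentially"
    by (rule eventually_mono[OF eventually_gt_at_top])
  then show ?thesis
    unfolding wiener_integral_def by (intro limI tendsto_eventually)
qed

text \<open>Reweighting the Girsanov measure by \<open>exp (L \<omega>)\<close> cancels its density
  and returns \<open>M\<close>, so uniqueness of the Radon-Nikodym derivative identifies the ratio,
  almost everywhere.\<close>

lemma log_likelihood_ratio_const:
  assumes "0 < T"
  shows "AE \<omega> in M. log_likelihood_ratio M W T (\<lambda>_. a) \<omega> = a * W T \<omega> + a\<^sup>2 * T / 2"
proof -
  have [measurable]: "W T \<in> borel_measurable M"
    using assms by (intro random_variable_W) simp
  define L where "L = (\<lambda>\<omega>. a * W T \<omega> + a\<^sup>2 * T / 2)"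
  have L[measurable]: "L \<in> borel_measurable M"
    unfolding L_def by measurable
  let ?G = "girsanov_measure M W T (\<lambda>_. a)"
  have G: "?G = density M (\<lambda>\<omega>. ennreal (exp (- L \<omega>)))"
    unfolding girsanov_measure_def
    using assms
    by (intro density_cong)
       (auto simp: wiener_integral_const set_lebesgue_integral_const_Icc L_def
         cong: measurable_cong)
  have sf: "sigma_finite_measure ?G"
    unfolding G by (subst sigma_finite_iff_density_finite) auto
  have "density ?G (\<lambda>\<omega>. ennreal (exp (L \<omega>))) =
      density M (\<lambda>\<omega>. ennreal (exp (- L \<omega>)) * ennreal (exp (L \<omega>)))"
    unfolding G by (intro density_density_eq) auto
  also have "\<dots> = M"
    by (simp add: ennreal_mult[symmetric] density_1 flip: exp_add)
  finally have "AE \<omega> in ?G. ennreal (exp (L \<omega>)) = RN_deriv ?G M \<omega>"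
    by (intro sigma_finite_measure.RN_deriv_unique[OF sf]) (auto simp: G)
  \<comment> \<open>The density \<open>exp (- L \<omega>)\<close> is positive, so the exceptional
    set is null under \<open>M\<close> too.\<close>
  then have "AE \<omega> in M. ennreal (exp (L \<omega>)) = RN_deriv ?G M \<omega>"
    unfolding G by (subst (asm) AE_density) auto
  then show ?thesis
  proof (rule AE_mp, intro AE_I2 impI)
    fix \<omega> assume "ennreal (exp (L \<omega>)) = RN_deriv ?G M \<omega>"
    then show "log_likelihood_ratio M W T (\<lambda>_. a) \<omega> = a * W T \<omega> + a\<^sup>2 * T / 2"
      by (simp add: log_likelihood_ratio_def entropy_density_def L_def log_def flip: \<open>_ = RN_deriv ?G M \<omega>\<close>)
  qed
qed

text \<open>Lets \<open>integral_cong_AE\<close> replace the ratio by its explicit form under the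
  integral.\<close>

lemma measurable_log_likelihood_ratio[measurable]:
  "log_likelihood_ratio M W T \<theta> \<in> borel_measurable M"
proof -
  have "sets (girsanov_measure M W T \<theta>) = sets M"
    by (simp add: girsanov_measure_def)
  then show ?thesis
    unfolding log_likelihood_ratio_def
    using measurable_entropy_density measurable_cong_sets[of _ M borel borel] by blast
qed

section \<open>Relative entropy, variance and their rates\<close>

lemma relative_entropy_const:
  assumes "0 < T"
  shows "relative_entropy M W T (\<lambda>_. a) = a\<^sup>2 * T / 2"
proof -
  have [measurable]: "W T \<in> borel_measurable M"
    using assms by (intro random_variable_W) simp
  have "relative_entropy M W T (\<lambda>_. a) = (\<integral>\<omega>. a * W T \<omega> + a\<^sup>2 * T / 2 \<partial>M)"
    unfolding relative_entropy_def
    by (intro integral_cong_AE log_likelihood_ratio_const assms) measurable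
  also have "\<dots> = a\<^sup>2 * T / 2"
    using assms by (simp add: integrable_W expectation_W prob_space)
  finally show ?thesis .
qed

text \<open>Centering removes the deterministic part of the ratio and leaves
  \<open>- a * W T \<omega>\<close>.\<close>

lemma relative_variance_const:
  assumes "0 < T"
  shows "relative_variance M W T (\<lambda>_. a) = a\<^sup>2 * T"
proof -
  have [measurable]: "W T \<in> borel_measurable M"
    using assms by (intro random_variable_W) simp
  have "relative_variance M W T (\<lambda>_. a) = (\<integral>\<omega>. a\<^sup>2 * (W T \<omega>)\<^sup>2 \<partial>M)"
    unfolding relative_variance_def
  proof (rule integral_cong_AE)
    show "AE \<omega> in M. (relative_entropy M W T (\<lambda>_. a) - log_likelihood_ratio M W T (\<lambda>_. a) \<omega>)\<^sup>2 =
        a\<^sup>2 * (W T \<omega>)\<^sup>2"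
      using log_likelihood_ratio_const[OF assms, of a]
      by eventually_elim (simp add: relative_entropy_const[OF assms] power_mult_distrib)
  qed measurable
  also have "\<dots> = a\<^sup>2 * T"
    using assms by (simp add: expectation_W_squared)
  finally show ?thesis .
qed

text \<open>The level \<open>a\<close> stays fixed while the horizon bound inside the rate grows;
  this permits \<open>a\<close> to be \<open>theta_bar T d c\<close> for an outer
  \<open>T\<close>.\<close>

lemma entropy_rate_const: "entropy_rate M W (\<lambda>_. a) = ereal (1/2 * a\<^sup>2)"
proof -
  have "eventually (\<lambda>T. ereal (1 / T * relative_entropy M W T (\<lambda>_. a)) = ereal (1/2 * a\<^sup>2)) at_top"
    using eventually_gt_at_top[of 0] by eventually_elim (simp add: relative_entropy_const)
  then have "entropy_rate M W (\<lambda>_. a) = Limsup at_top (\<lambda>T::real. ereal (1/2 * a\<^sup>2))"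
    unfolding entropy_rate_def by (rule Limsup_eq)
  then show ?thesis by (simp add: Limsup_const)
qed

lemma variance_rate_const: "variance_rate M W (\<lambda>_. a) = ereal (a\<^sup>2)"
proof -
  have "eventually (\<lambda>T. ereal (1 / T * relative_variance M W T (\<lambda>_. a)) = ereal (a\<^sup>2)) at_top"
    using eventually_gt_at_top[of 0] by eventually_elim (simp add: relative_variance_const)
  then have "variance_rate M W (\<lambda>_. a) = Limsup at_top (\<lambda>T::real. ereal (a\<^sup>2))"
    unfolding variance_rate_def by (rule Limsup_eq)
  then show ?thesis by (simp add: Limsup_const)
qed

section \<open>Failure rate of the threshold test and its exponent\<close>

lemma failure_rate_phi_star:
  assumes "0 < T"
  shows "failure_rate M W T (\<lambda>_. a) (phi_star T \<epsilon>) = Phi (Phi_inv (1 - \<epsilon>) - sqrt T * a)"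
proof -
  have [measurable]: "W T \<in> borel_measurable M"
    using assms by (intro random_variable_W) simp
  \<comment> \<open>The alarm threshold less the drift \<open>a * T\<close>: no alarm is raised
    exactly when \<open>W T \<omega> \<le> x\<close>.\<close>
  define x where "x = sqrt T * Phi_inv (1 - \<epsilon>) - a * T"
  let ?A = "{\<omega> \<in> space M. W T \<omega> \<le> x}"
  have "(\<integral>\<omega>. phi_star T \<epsilon> (trajectory W T (\<lambda>_. a) \<omega>) \<partial>M) = (\<integral>\<omega>. indicator (space M - ?A) \<omega> \<partial>M)"
    using assms
    by (intro Bochner_Integration.integral_cong)
       (auto simp: phi_star_def trajectory_def set_lebesgue_integral_const_Icc x_def indicator_def)
  also have "\<dots> = 1 - measure M ?A"
    by (simp add: prob_compl)
  finally have "failure_rate M W T (\<lambda>_. a) (phi_star T \<epsilon>) = Phi (x / sqrt T)"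
    using assms by (simp add: failure_rate_def prob_W_le)
  also have "x / sqrt T = Phi_inv (1 - \<epsilon>) - sqrt T * a"
  proof -
    have "x = sqrt T * (Phi_inv (1 - \<epsilon>) - sqrt T * a)"
      using assms by (simp add: x_def right_diff_distrib flip: mult.assoc)
    with assms show ?thesis by simp
  qed
  finally show ?thesis .
qed

lemma failure_rate_exponent:
  assumes "0 < T" "0 < a" "0 < \<epsilon>" "\<epsilon> < 1/2"
  shows "- ln (failure_rate M W T (\<lambda>_. a) (phi_star T \<epsilon>)) \<ge>
    T * (1/2 * a\<^sup>2) + sqrt T * sqrt (a\<^sup>2) * Phi_inv \<epsilon>"
proof -
  \<comment> \<open>By reflection \<open>q\<close> is the quantile
    \<open>Phi_inv (1 - \<epsilon>)\<close> of the test, and \<open>- u\<close> is the argument of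
    \<open>Phi\<close> in the failure rate.\<close>
  define q where "q = - Phi_inv \<epsilon>"
  define u where "u = sqrt T * a - q"
  have q: "0 < q"
    using Phi_inv_neg assms by (simp add: q_def)
  have fr: "failure_rate M W T (\<lambda>_. a) (phi_star T \<epsilon>) = Phi (- u)"
    using assms by (simp add: failure_rate_phi_star Phi_inv_one_minus u_def q_def add.commute)
  \<comment> \<open>Completing the square, with \<open>sqrt (a\<^sup>2) = a\<close> because
    \<open>a\<close> is positive.\<close>
  have "T * (1/2 * a\<^sup>2) + sqrt T * sqrt (a\<^sup>2) * Phi_inv \<epsilon> = u\<^sup>2 / 2 - q\<^sup>2 / 2"
    using assms by (simp add: u_def q_def power2_diff power2_sum power_mult_distrib field_simps)
  also have "\<dots> \<le> - ln (Phi (- u))"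
  proof (cases "0 \<le> u")
    case True
    have "ln (Phi (- u)) \<le> ln (exp (- u\<^sup>2 / 2))"
      using Phi_tail_le[OF True] Phi_pos[of "- u"] by (subst ln_le_cancel_iff) auto
    then have "u\<^sup>2 / 2 \<le> - ln (Phi (- u))"
      by simp
    then show ?thesis
      using zero_le_power2[of q] by linarith
  next
    case False
    have "0 \<le> sqrt T * a"
      using assms by simp
    then have "\<bar>u\<bar> \<le> \<bar>q\<bar>"
      using False q by (simp add: u_def)
    then have "u\<^sup>2 \<le> q\<^sup>2"
      by (simp add: abs_le_square_iff)
    moreover have "ln (Phi (- u)) \<le> 0"
      using Phi_le_1 Phi_pos by (simp add: ln_le_zero_iff)
    ultimately show ?thesis by simp
  qed
  finally show ?thesis by (simp add: fr)
qed

end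

lemma theta_bar_pos:
  assumes "0 < T" "0 < d" "1/2 < c" "c < 1"
  shows "0 < theta_bar T d c"
  using assms Phi_inv_pos[of c] by (simp add: theta_bar_def add_pos_pos)

theorem mainTheorem4:
  fixes M :: "'a measure" and W :: "real \<Rightarrow> 'a \<Rightarrow> real" and d c \<epsilon> :: real
  assumes bm: "brownian_motion M W"
    and d: "d > 0"
    and c: "1/2 < c" "c < 1"
    and eps: "0 < \<epsilon>" "\<epsilon> < 1/2"
    and saddle: "\<And>T. T > 0 \<Longrightarrow>
      saddle_point M W T d c \<epsilon> (\<lambda>_. theta_bar T d c) (phi_star T \<epsilon>)"
  shows "(\<forall>T>0. entropy_rate M W (\<lambda>_. theta_bar T d c) = ereal (1/2 * (theta_bar T d c)\<^sup>2) \<and>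
                variance_rate M W (\<lambda>_. theta_bar T d c) = ereal ((theta_bar T d c)\<^sup>2)) \<and>
         (\<exists>const :: real.
            (\<forall>T>0. - ln (failure_rate M W T (\<lambda>_. theta_bar T d c) (phi_star T \<epsilon>)) \<ge>
               T * real_of_ereal (entropy_rate M W (\<lambda>_. theta_bar T d c)) +
               sqrt T * sqrt (real_of_ereal (variance_rate M W (\<lambda>_. theta_bar T d c))) * Phi_inv \<epsilon> +
               const) \<and>
            (\<forall>T\<^sub>0>0. \<forall>T>0. - ln (failure_rate M W T (\<lambda>_. theta_bar T\<^sub>0 d c) (phi_star T \<epsilon>)) \<ge>
               T * real_of_ereal (entropy_rate M W (\<lambda>_. theta_bar T\<^sub>0 d c)) +
               sqrt T * sqrt (real_of_ereal (variance_rate M W (\<lambda>_. theta_bar T\<^sub>0 d c))) * Phi_inv \<epsilon> +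
               const))"
proof -
  interpret brownian_motion M W by (fact bm)
  have rates: "entropy_rate M W (\<lambda>_. a) = ereal (1/2 * a\<^sup>2)"
      "variance_rate M W (\<lambda>_. a) = ereal (a\<^sup>2)" for a
    by (fact entropy_rate_const variance_rate_const)+
  \<comment> \<open>\<open>T\<^sub>0\<close> sets the signal level and \<open>T\<close> the horizon;
    \<open>T\<^sub>0 = T\<close> gives the first bound, distinct values the second. The summand 0 is
    the witness for the constant.\<close>
  have bound: "- ln (failure_rate M W T (\<lambda>_. theta_bar T\<^sub>0 d c) (phi_star T \<epsilon>)) \<ge>
      T * (1/2 * (theta_bar T\<^sub>0 d c)\<^sup>2) + sqrt T * sqrt ((theta_bar T\<^sub>0 d c)\<^sup>2) * Phi_inv \<epsilon> + 0"
    if "0 < T" "0 < T\<^sub>0" for T T\<^sub>0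
    using failure_rate_exponent[OF that(1) theta_bar_pos[OF that(2) d c] eps] by simp
  show ?thesis
    unfolding rates real_of_ereal.simps
    by (intro conjI exI[of _ 0] allI impI refl bound)
qed

end
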